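(* Let $V$ be a vector space over a field, let $U$ be a subspace of $V$ with $U\neq V$, and let $L_{GL(U)}(V)=\{\alpha\in L(V):\alpha|_U\in GL(U)\}$. Let $E(L_{GL(U)}(V))$ be the set of idempotents of $L_{GL(U)}(V)$ and let \[ M=\{\alpha\in E(L_{GL(U)}(V)):V\alpha=U\}. \] Then $M$ is the set of all minimal idempotents in $L_{GL(U)}(V)$.
   Context: $L(V)$ is the semigroup of all linear maps $V\to V$ under composition; maps are written on the right and composed from left to right, and $V\alpha$ is the range of $\alpha$. $GL(U)$ is the group of all bijective linear maps $U\to U$; $\alpha|_U\in GL(U)$ means that $\alpha$ restricts to a bijection of $U$ onto $U$. For a semigroup $S$, the natural partial order on its set $E(S)$ of idempotents is: $e\leq f$ iff $e=ef=fe$. A minimal idempotent of $S$ is an $e\in E(S)$ for which there is no $f\in E(S)$ with $f<e$ (that is, $f\le e$ and $f\ne e$). *)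

theory Defs
  imports Complex_Main
begin

text \<open>The vector space \<open>V\<close> is the whole type \<open>'v\<close>, with scalar multiplication \<open>scale\<close>.\<close>

definition linear_maps :: "('k::field \<Rightarrow> 'v::ab_group_add \<Rightarrow> 'v) \<Rightarrow> ('v \<Rightarrow> 'v) set" where
  "linear_maps scale = {\<alpha>. Vector_Spaces.linear scale scale \<alpha>}"

definition L_GL :: "('k::field \<Rightarrow> 'v::ab_group_add \<Rightarrow> 'v) \<Rightarrow> 'v set \<Rightarrow> ('v \<Rightarrow> 'v) set" where
  "L_GL scale U = {\<alpha> \<in> linear_maps scale. bij_betw \<alpha> U U}"

text \<open>Maps are written on the right: the product \<open>comp_lr \<alpha> \<beta>\<close> applies \<open>\<alpha>\<close> first.\<close>

definition comp_lr :: "('v \<Rightarrow> 'v) \<Rightarrow> ('v \<Rightarrow> 'v) \<Rightarrow> 'v \<Rightarrow> 'v" where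
  "comp_lr \<alpha> \<beta> = \<beta> \<circ> \<alpha>"

text \<open>In the following, a semigroup is given by its carrier \<open>S\<close> and its multiplication \<open>mul\<close>.\<close>

definition idempotents :: "('a \<Rightarrow> 'a \<Rightarrow> 'a) \<Rightarrow> 'a set \<Rightarrow> 'a set" where
  "idempotents mul S = {e \<in> S. mul e e = e}"

text \<open>The natural partial order; it is only meant to be applied to idempotents.\<close>

definition nat_le :: "('a \<Rightarrow> 'a \<Rightarrow> 'a) \<Rightarrow> 'a \<Rightarrow> 'a \<Rightarrow> bool" where
  "nat_le mul e f \<longleftrightarrow> e = mul e f \<and> e = mul f e"

definition minimal_idempotents :: "('a \<Rightarrow> 'a \<Rightarrow> 'a) \<Rightarrow> 'a set \<Rightarrow> 'a set" where
  "minimal_idempotents mul S =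
     {e \<in> idempotents mul S. \<not> (\<exists>f \<in> idempotents mul S. nat_le mul f e \<and> f \<noteq> e)}"

end

theory Submission imports Defs begin

text \<open>An idempotent of \<open>L_GL scale U\<close> is injective on \<open>U\<close> and hence the identity there. So if
  its range is \<open>U\<close>, every idempotent below it coincides with it. Conversely, composing an
  idempotent \<open>\<alpha>\<close> with a linear projection onto \<open>U\<close> yields an idempotent below \<open>\<alpha>\<close> with
  range \<open>U\<close>, which equals \<open>\<alpha>\<close> when \<open>\<alpha>\<close> is minimal.\<close>

lemma idempotent_L_GL_fixes:
  assumes "e \<in> idempotents comp_lr (L_GL scale U)" and "u \<in> U"
  shows "e u = u"
proof -
  have b: "bij_betw e U U" and i: "e (e u) = e u"
    using assms(1) by (auto simp: idempotents_def L_GL_def comp_lr_def fun_eq_iff)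
  have "e u \<in> U"
    using b assms(2) by (rule bij_betwE[THEN bspec])
  with i assms(2) show ?thesis
    using b by (auto simp: bij_betw_def dest: inj_onD)
qed

text \<open>Serves to recognise the composite with a projection. Idempotence comes from the values
  lying in \<open>U\<close>, where a second application of \<open>e\<close> changes nothing.\<close>

lemma idempotent_L_GLI:
  assumes "Vector_Spaces.linear scale scale e"
    and fixes_U: "\<And>u. u \<in> U \<Longrightarrow> e u = u" and into: "\<And>x. e x \<in> U"
  shows "e \<in> idempotents comp_lr (L_GL scale U)"
proof -
  have "bij_betw e U U"
    using fixes_U bij_betw_cong[of U e id U] by auto
  then show ?thesis
    using assms by (auto simp: idempotents_def L_GL_def linear_maps_def comp_lr_def)
qed

lemma (in vector_space) linear_projection_exists:
  assumes "subspace U"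
  obtains p where "Vector_Spaces.linear scale scale p" "\<And>x. p x \<in> U" "\<And>u. u \<in> U \<Longrightarrow> p u = u"
proof -
  interpret vector_space_pair scale scale by unfold_locales
  \<comment> \<open>Here \<open>id\<close> plays the inclusion of \<open>U\<close> into the space; a
    linear left inverse of it with values in \<open>U\<close> is a projection.\<close>
  have "\<exists>g. g ` UNIV \<subseteq> U \<and> Vector_Spaces.linear scale scale g \<and> (\<forall>v\<in>U. g (id v) = v)"
    using assms by (intro linear_exists_left_inverse_on linear_id) auto
  then show thesis
    using that by auto
qed

theorem theorem4p2:
  fixes scale :: "'k::field \<Rightarrow> 'v::ab_group_add \<Rightarrow> 'v"
    and U :: "'v set"
  assumes "vector_space scale"
    and "module.subspace scale U"
    and "U \<noteq> UNIV"
  shows "{\<alpha> \<in> idempotents comp_lr (L_GL scale U). range \<alpha> = U}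
       = minimal_idempotents comp_lr (L_GL scale U)"
proof (intro set_eqI iffI)
  fix \<alpha> assume "\<alpha> \<in> {\<alpha> \<in> idempotents comp_lr (L_GL scale U). range \<alpha> = U}"
  then have \<alpha>: "\<alpha> \<in> idempotents comp_lr (L_GL scale U)" and r: "range \<alpha> = U"
    by auto
  have "f = \<alpha>" if f: "f \<in> idempotents comp_lr (L_GL scale U)" and le: "nat_le comp_lr f \<alpha>" for f
  proof
    fix x
    \<comment> \<open>This is the half \<open>f = comp_lr \<alpha> f\<close> of the order, in which
      \<alpha> acts first.\<close>
    have "f x = f (\<alpha> x)"
      using le by (auto simp: nat_le_def comp_lr_def fun_eq_iff)
    also have "\<dots> = \<alpha> x"
      using r by (intro idempotent_L_GL_fixes[OF f]) auto
    finally show "f x = \<alpha> x" .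
  qed
  with \<alpha> show "\<alpha> \<in> minimal_idempotents comp_lr (L_GL scale U)"
    by (auto simp: minimal_idempotents_def)
next
  fix \<alpha> assume "\<alpha> \<in> minimal_idempotents comp_lr (L_GL scale U)"
  then have \<alpha>: "\<alpha> \<in> idempotents comp_lr (L_GL scale U)"
    and min: "\<And>f. f \<in> idempotents comp_lr (L_GL scale U) \<Longrightarrow> nat_le comp_lr f \<alpha> \<Longrightarrow> f = \<alpha>"
    by (auto simp: minimal_idempotents_def)
  interpret vector_space scale by fact
  obtain p where p: "Vector_Spaces.linear scale scale p" "\<And>x. p x \<in> U" "\<And>u. u \<in> U \<Longrightarrow> p u = u"
    using linear_projection_exists assms(2) by blast
  have lin: "Vector_Spaces.linear scale scale \<alpha>" and idem: "\<And>x. \<alpha> (\<alpha> x) = \<alpha> x"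
    using \<alpha> by (auto simp: idempotents_def L_GL_def linear_maps_def comp_lr_def fun_eq_iff)
  note fixes_U = idempotent_L_GL_fixes[OF \<alpha>]
  have "p \<circ> \<alpha> \<in> idempotents comp_lr (L_GL scale U)"
    using p fixes_U by (intro idempotent_L_GLI Vector_Spaces.linear_compose[OF lin p(1)]) auto
  \<comment> \<open>Applying \<alpha> after \<open>p \<circ> \<alpha>\<close> changes nothing
    because \<alpha> fixes the values of \<open>p\<close>; applying it before changes nothing
    because \<alpha> is idempotent.\<close>
  moreover have "nat_le comp_lr (p \<circ> \<alpha>) \<alpha>"
    using p(2) fixes_U idem by (auto simp: nat_le_def comp_lr_def fun_eq_iff)
  ultimately have eq: "p \<circ> \<alpha> = \<alpha>"
    by (rule min)
  have "\<alpha> x \<in> U" for x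
    using p(2)[of "\<alpha> x"] fun_cong[OF eq, of x] by simp
  \<comment> \<open>Each vector of \<open>U\<close> is its own image under \<alpha>.\<close>
  moreover have "U \<subseteq> range \<alpha>"
    using fixes_U by (metis rangeI subsetI)
  ultimately show "\<alpha> \<in> {\<alpha> \<in> idempotents comp_lr (L_GL scale U). range \<alpha> = U}"
    using \<alpha> by auto
qed

end
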